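(* Let $n\ge2$ be an integer and $a,b,c\in2\mathbb N$. With $f$ as below, $$f(a,b,c,0)=\frac{(n-2)!\,(n-2)!!}{P_{n-1}}\cdot\frac{F_0}{F_{n-2}},$$ where $F_k=F_k(a,b,c,0)$ and $P_k=P_k(a,b,c,0)$; explicitly, $$f(a,b,c,0)=\frac{(n-2)!\,a!!\,b!!\,c!!}{(a+n-2)!!\,(b+n-2)!!\,(c+n-2)!!\,(a+b+c+n-1)!!}.$$
   Context: $f(a,b,c,d)=I_n\begin{pmatrix}a&c\\ b&d\end{pmatrix}/\big((a+d+n-2)!!\,(b+c+n-2)!!\big)$, where $I_n\begin{pmatrix}a&c\\ b&d\end{pmatrix}=\int_{O_n}u_{11}^a u_{12}^c u_{21}^b u_{22}^d\,du$ (Haar probability measure). $F_k(a,b,c,d)=(a+k)!!(b+k)!!(c+k)!!(d+k)!!$ and $P_k(a,b,c,d)=(a+b+c+d+k)!!$. Double factorial convention: for an integer $m\ge0$, $m!!=(m-1)(m-3)\cdots$, the product of the positive integers $\le m-1$ of the parity of $m-1$ (empty product $=1$); $(n-2)!$ is the ordinary factorial. *)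

theory Defs
  imports "HOL-Probability.Probability"
begin

text \<open>Double factorial with the paper's convention:
  m!! = (m-1)(m-3)..., the product of the positive integers at most m-1
  having the parity of m-1 (empty product = 1).\<close>
fun dfact :: "nat \<Rightarrow> nat" where
  "dfact 0 = 1"
| "dfact (Suc 0) = 1"
| "dfact (Suc (Suc m)) = Suc m * dfact m"

definition orth_group :: "(real^'n^'n) set" where
  "orth_group = {U. transpose U ** U = mat 1}"

definition haar_orth :: "(real^'n^'n) measure" where
  "haar_orth = (THE \<mu>. sets \<mu> = sets borel \<and> prob_space \<mu> \<and>
       emeasure \<mu> orth_group = 1 \<and>
       (\<forall>Q\<in>orth_group. distr \<mu> borel (\<lambda>U. Q ** U) = \<mu>))"

definition idx1 :: "'n::{finite,linorder}" where
  "idx1 = Min UNIV"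

definition idx2 :: "'n::{finite,linorder}" where
  "idx2 = Min (UNIV - {idx1})"

definition Iint :: "'n::{finite,linorder} itself \<Rightarrow> nat \<Rightarrow> nat \<Rightarrow> nat \<Rightarrow> nat \<Rightarrow> real" where
  "Iint _ a c b d = (\<integral>U. (U $ (idx1::'n::{finite,linorder}) $ idx1) ^ a * (U $ idx1 $ (idx2::'n::{finite,linorder})) ^ c
        * (U $ idx2 $ idx1) ^ b * (U $ idx2 $ idx2) ^ d \<partial>(haar_orth :: (real^'n::{finite,linorder}^'n::{finite,linorder}) measure))"

definition f_fun :: "'n::{finite,linorder} itself \<Rightarrow> nat \<Rightarrow> nat \<Rightarrow> nat \<Rightarrow> nat \<Rightarrow> real" where
  "f_fun t a b c d = Iint t a c b d /
     (real (dfact (a + d + CARD('n::{finite,linorder}) - 2)) * real (dfact (b + c + CARD('n) - 2)))"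

definition F_k :: "nat \<Rightarrow> nat \<Rightarrow> nat \<Rightarrow> nat \<Rightarrow> nat \<Rightarrow> nat" where
  "F_k k a b c d = dfact (a + k) * dfact (b + k) * dfact (c + k) * dfact (d + k)"

definition P_k :: "nat \<Rightarrow> nat \<Rightarrow> nat \<Rightarrow> nat \<Rightarrow> nat \<Rightarrow> nat" where
  "P_k k a b c d = dfact (a + b + c + d + k)"

end

theory Submission
  imports Defs
begin

text \<open>Haar measure on the orthogonal group exists because Gram--Schmidt is equivariant under left
  multiplication by orthogonal matrices, so it pushes a rotation-invariant law on matrices forward to a
  left-invariant one; a Fubini argument shows that it is unique and invariant under transposition.

  Rotating two rows expresses the moments of one entry through those of the other, and since the
  columns are unit vectors this yields
  \<open>\<integral> g u\<^sub>2\<^sub>1 ^ b = const \<cdot> \<integral> g (1 - u\<^sub>1\<^sub>1\<^sup>2) ^ (b / 2)\<close>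
  whenever \<open>g\<close> depends on the first row only.  Applied to \<open>u\<^sub>2\<^sub>1\<close> and, after transposing, to
  \<open>u\<^sub>1\<^sub>2\<close>, it reduces the integral to a Beta-type moment of the single entry \<open>u\<^sub>1\<^sub>1\<close>.\<close>

section \<open>Lebesgue measure under orthogonal transformations\<close>

lemma nn_integral_lborel_shift:
  fixes h :: "'a::euclidean_space \<Rightarrow> ennreal"
  assumes [measurable]: "h \<in> borel_measurable borel"
  shows "(\<integral>\<^sup>+x. h (x + c) \<partial>lborel) = (\<integral>\<^sup>+x. h x \<partial>lborel)"
proof -
  have "(\<integral>\<^sup>+x. h x \<partial>lborel) = (\<integral>\<^sup>+x. h x \<partial>distr lborel borel ((+) c))"
    by (simp add: lborel_distr_plus)
  also have "\<dots> = (\<integral>\<^sup>+x. h (x + c) \<partial>lborel)"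
    by (subst nn_integral_distr) (auto simp: add.commute)
  finally show ?thesis ..
qed

text \<open>Double counting: the measure of the pairs \<open>(x, y)\<close> with \<open>y\<close> in
  \<open>A\<close> and \<open>y - f x\<close> in the unit ball is computed in both orders. As
  \<open>f\<close> is an isometry and Lebesgue measure is translation invariant, the two results are
  the volume of the ball times the measure of \<open>A\<close> and of its preimage. No determinant
  enters.\<close>

lemma lborel_distr_orthogonal_transformation:
  fixes f :: "'a::euclidean_space \<Rightarrow> 'a"
  assumes f: "orthogonal_transformation f"
  shows "distr lborel borel f = lborel"
proof (rule measure_eqI)
  fix A assume "A \<in> sets (distr lborel borel f)"
  then have A[measurable]: "A \<in> sets borel" by simp
  define g where "g = inv f"
  have fg: "f (g y) = y" for y
    unfolding g_def using orthogonal_transformation_surj[OF f] by (simp add: surj_f_inv_f)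
  have lin: "linear f" using f by (rule orthogonal_transformation_linear)
  have [measurable]: "f \<in> borel_measurable borel"
    using lin by (intro borel_measurable_continuous_onI linear_continuous_on linear_conv_bounded_linear[THEN iffD1])
  have [measurable]: "f -` A \<in> sets borel"
    by (rule measurable_sets_borel[of f]) measurable
  have [measurable]: "ball (0::'a) 1 \<in> sets borel" by simp
  define \<kappa> where "\<kappa> = emeasure lborel (ball (0::'a) 1)"
  define K where "K = (\<lambda>x y. indicator A y * indicator (ball 0 1) (y - f x) :: ennreal)"
  have ball: "indicator (ball 0 1) (y - f x) = (indicator (ball 0 1) (x + - g y) :: ennreal)" for x y
  proof -
    have "norm (x - g y) = norm (f (x - g y))"
      using f by (simp add: orthogonal_transformation)
    also have "\<dots> = norm (y - f x)"
      using lin by (simp add: linear_diff fg norm_minus_commute)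
    finally show ?thesis by (simp add: indicator_def)
  qed
  have "\<kappa> * emeasure lborel A = (\<integral>\<^sup>+y. \<kappa> * indicator A y \<partial>lborel)"
    by (simp add: nn_integral_cmult_indicator)
  also have "\<dots> = (\<integral>\<^sup>+y. (\<integral>\<^sup>+x. K x y \<partial>lborel) \<partial>lborel)"
  proof (rule nn_integral_cong)
    fix y :: 'a
    have "(\<integral>\<^sup>+x. K x y \<partial>lborel) = (\<integral>\<^sup>+x. indicator A y * indicator (ball (0::'a) 1) x \<partial>lborel)"
      unfolding K_def ball 
      by (rule nn_integral_lborel_shift[where h = "\<lambda>x. indicator A y * indicator (ball 0 1) x"]) measurable
    then show "\<kappa> * indicator A y = (\<integral>\<^sup>+x. K x y \<partial>lborel)"
      by (simp add: nn_integral_cmult_indicator \<kappa>_def mult.commute)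
  qed
  also have "\<dots> = (\<integral>\<^sup>+x. (\<integral>\<^sup>+y. K x y \<partial>lborel) \<partial>lborel)"
    unfolding K_def by (intro lborel_pair.Fubini') measurable
  \<comment> \<open>Translating \<open>y\<close> by \<open>f x\<close> makes the ball factor
    independent of \<open>x\<close>; the other factor then tests whether \<open>x + g y\<close> lies
    in the preimage of \<open>A\<close>.\<close>
  also have "\<dots> = (\<integral>\<^sup>+x. (\<integral>\<^sup>+y. K x (y + f x) \<partial>lborel) \<partial>lborel)"
    unfolding K_def by (subst nn_integral_lborel_shift) auto
  also have "\<dots> = (\<integral>\<^sup>+y. (\<integral>\<^sup>+x. K x (y + f x) \<partial>lborel) \<partial>lborel)"
    unfolding K_def by (intro lborel_pair.Fubini'[symmetric]) measurable
  also have "\<dots> = (\<integral>\<^sup>+y. emeasure lborel (f -` A) * indicator (ball (0::'a) 1) y \<partial>lborel)"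
  proof (rule nn_integral_cong)
    fix y :: 'a
    have "(\<integral>\<^sup>+x. K x (y + f x) \<partial>lborel)
        = (\<integral>\<^sup>+x. indicator (f -` A) (x + g y) * indicator (ball 0 1) y \<partial>lborel)"
      by (intro nn_integral_cong) (simp add: K_def indicator_def linear_add[OF lin] fg add.commute)
    also have "\<dots> = (\<integral>\<^sup>+x. indicator (f -` A) x * indicator (ball 0 1) y \<partial>lborel)"
      by (rule nn_integral_lborel_shift) measurable
    also have "\<dots> = emeasure lborel (f -` A) * indicator (ball 0 1) y"
      by (simp add: nn_integral_multc)
    finally show "(\<integral>\<^sup>+x. K x (y + f x) \<partial>lborel) = \<dots>" .
  qed
  also have "\<dots> = \<kappa> * emeasure lborel (f -` A)"
    by (simp add: nn_integral_cmult_indicator \<kappa>_def mult.commute[of _ "emeasure lborel (f -` A)"])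
  finally have eq: "\<kappa> * emeasure lborel A = \<kappa> * emeasure lborel (f -` A)" .
  have "\<kappa> \<noteq> 0" "\<kappa> \<noteq> \<infinity>"
    using emeasure_lborel_ball_finite[of "0::'a" 1] content_ball_pos[of 1 "0::'a"]
    by (auto simp: \<kappa>_def measure_def)
  with eq have "emeasure lborel A = emeasure lborel (f -` A)"
    by (simp add: ennreal_mult_cancel_left)
  then show "emeasure (distr lborel borel f) A = emeasure lborel A"
    by (simp add: emeasure_distr)
qed simp

section \<open>The orthogonal group and its action by left multiplication\<close>

lemma orth_group_iff: "U \<in> orth_group \<longleftrightarrow> orthogonal_matrix U"
  by (simp add: orth_group_def orthogonal_matrix)

lemma column_matrix_mult: "column j (A ** B) = A *v column j (B :: real^'m^'n)"
  by (simp add: column_def matrix_matrix_mult_def matrix_vector_mult_def vec_eq_iff)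

lemma inner_orth_mult_vec:
  assumes "Q \<in> orth_group"
  shows "(Q *v x) \<bullet> (Q *v y) = x \<bullet> y"
proof -
  have "(Q *v x) \<bullet> (Q *v y) = x \<bullet> ((transpose Q ** Q) *v y)"
    by (metis dot_lmul_matrix matrix_vector_mul_assoc transpose_transpose vector_transpose_matrix)
  then show ?thesis using assms by (simp add: orth_group_def)
qed

lemma norm_orth_mult_vec: "Q \<in> orth_group \<Longrightarrow> norm (Q *v x) = norm x"
  by (simp add: norm_eq_sqrt_inner inner_orth_mult_vec)

lemma inner_matrix_columns: "A \<bullet> B = (\<Sum>j\<in>UNIV. column j A \<bullet> column j (B :: real^'m^'n))"
  unfolding inner_vec_def column_def by (simp, rule sum.swap)

lemma orthogonal_transformation_orth_mult:
  assumes "Q \<in> orth_group"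
  shows "orthogonal_transformation (\<lambda>X. Q ** (X :: real^'m^'n))"
  unfolding orthogonal_transformation_def
proof (intro conjI allI)
  show "linear (\<lambda>X. Q ** (X :: real^'m^'n))"
    by (rule linearI) (simp_all add: matrix_matrix_mult_def vec_eq_iff sum_distrib_left sum.distrib algebra_simps)
qed (simp add: inner_matrix_columns column_matrix_mult inner_orth_mult_vec[OF assms])

lemma continuous_on_matrix_mult [continuous_intros]:
  fixes f :: "'a::topological_space \<Rightarrow> real^'m^'n" and g :: "'a \<Rightarrow> real^'k^'m"
  shows "continuous_on S f \<Longrightarrow> continuous_on S g \<Longrightarrow> continuous_on S (\<lambda>x. f x ** g x)"
  unfolding matrix_matrix_mult_def by (intro continuous_intros)

lemma continuous_on_transpose [continuous_intros]:
  fixes f :: "'a::topological_space \<Rightarrow> real^'m^'n"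
  shows "continuous_on S f \<Longrightarrow> continuous_on S (\<lambda>x. transpose (f x))"
  unfolding transpose_def by (intro continuous_intros)

lemma norm_orth_mult: "Q \<in> orth_group \<Longrightarrow> norm (Q ** X) = norm (X :: real^'m^'n)"
  using orthogonal_transformation_orth_mult orthogonal_transformation by blast

lemma compact_orth_group: "compact (orth_group :: (real^'n^'n) set)"
  unfolding compact_eq_bounded_closed
proof
  show "bounded (orth_group :: (real^'n^'n) set)"
  proof (rule boundedI)
    fix U :: "real^'n^'n" assume "U \<in> orth_group"
    from norm_orth_mult[OF this, of "mat 1"] show "norm U \<le> norm (mat 1 :: real^'n^'n)" by simp
  qed
  show "closed (orth_group :: (real^'n^'n) set)"
    unfolding orth_group_def by (intro closed_Collect_eq continuous_intros)
qed

lemma orth_group_borel [measurable]: "orth_group \<in> sets borel"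
  by (intro borel_closed compact_imp_closed compact_orth_group)

section \<open>Gram--Schmidt orthonormalisation\<close>

function gs_residual :: "real^'n::{finite,linorder}^'n::{finite,linorder} \<Rightarrow> 'n::{finite,linorder} \<Rightarrow> real^'n::{finite,linorder}" where
  "gs_residual X j = column j X - (\<Sum>i\<in>{..<j}. (column j X \<bullet> sgn (gs_residual X i)) *\<^sub>R sgn (gs_residual X i))"
  by auto
termination
  by (relation "Wellfounded.measure (\<lambda>(X, j). card {..<j})") (auto intro: psubset_card_mono)

declare gs_residual.simps [simp del]

definition gram_schmidt :: "real^'n::{finite,linorder}^'n::{finite,linorder} \<Rightarrow> real^'n::{finite,linorder}^'n::{finite,linorder}" where
  "gram_schmidt X = (\<chi> i j. sgn (gs_residual X j) $ i)"

lemma finite_less_induct: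
  fixes j :: "'n::{finite,linorder}"
  assumes "\<And>j. (\<And>i. i < j \<Longrightarrow> P i) \<Longrightarrow> P j"
  shows "P j"
  by (induction "card {..<j}" arbitrary: j rule: less_induct)
    (metis assms finite lessThan_strict_subset_iff psubset_card_mono)

lemma column_gram_schmidt: "column j (gram_schmidt X) = sgn (gs_residual X j)"
  by (simp add: gram_schmidt_def column_def vec_eq_iff)

lemma sgn_orth_mult_vec: "Q \<in> orth_group \<Longrightarrow> sgn (Q *v x) = Q *v sgn x"
  by (simp add: sgn_div_norm norm_orth_mult_vec matrix_vector_mult_scaleR)

text \<open>\<open>Q\<close> preserves the inner products that serve as coefficients and, preserving
  norms, commutes with \<open>sgn\<close>. Since \<open>sgn 0 = 0\<close>, this holds for singular
  \<open>X\<close> as well.\<close>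

lemma gs_residual_equivariant:
  assumes "Q \<in> orth_group"
  shows "gs_residual (Q ** X) j = Q *v gs_residual X j"
proof (induction j rule: finite_less_induct)
  case (1 j)
  have "gs_residual (Q ** X) j = Q *v column j X
     - (\<Sum>i\<in>{..<j}. (column j X \<bullet> sgn (gs_residual X i)) *\<^sub>R (Q *v sgn (gs_residual X i)))"
    by (subst gs_residual.simps) (simp add: 1 sgn_orth_mult_vec assms inner_orth_mult_vec column_matrix_mult)
  also have "\<dots> = Q *v gs_residual X j"
    by (subst (2) gs_residual.simps)
      (simp add: matrix_vector_mult_diff_distrib matrix_vector_mult_scaleR linear_sum[OF matrix_vector_mul_linear])
  finally show ?case .
qed

lemma gram_schmidt_equivariant:
  "Q \<in> orth_group \<Longrightarrow> gram_schmidt (Q ** X) = Q ** gram_schmidt X"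
  unfolding gram_schmidt_def
  by (simp add: gs_residual_equivariant sgn_orth_mult_vec)
    (simp add: vec_eq_iff matrix_matrix_mult_def matrix_vector_mult_def)

lemma gs_residual_orthogonal:
  "i < j \<Longrightarrow> gs_residual X j \<bullet> sgn (gs_residual X i) = 0"
proof (induction j arbitrary: i rule: finite_less_induct)
  case (1 j)
  let ?e = "\<lambda>i. sgn (gs_residual X i)"
  have orth: "?e k \<bullet> ?e i = 0" if "k < j" "k \<noteq> i" for k
    using that 1(1)[OF that(1), of i] 1(1)[OF 1(2), of k]
    by (cases k i rule: linorder_cases) (auto simp: sgn_div_norm inner_commute)
  have "gs_residual X j \<bullet> ?e i = column j X \<bullet> ?e i - (\<Sum>k\<in>{..<j}. (column j X \<bullet> ?e k) * (?e k \<bullet> ?e i))"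
    by (subst gs_residual.simps) (simp add: inner_diff_left inner_sum_left)
  \<comment> \<open>By the induction hypothesis the earlier directions are mutually orthogonal, so
    only \<open>k = i\<close> survives.\<close>
  also have "(\<Sum>k\<in>{..<j}. (column j X \<bullet> ?e k) * (?e k \<bullet> ?e i))
      = (\<Sum>k\<in>{..<j}. if k = i then (column j X \<bullet> ?e i) * (?e i \<bullet> ?e i) else 0)"
    by (intro sum.cong) (auto simp: orth)
  also have "\<dots> = (column j X \<bullet> ?e i) * (?e i \<bullet> ?e i)"
    using 1(2) by simp
  \<comment> \<open>\<open>?e i\<close> is a unit vector, or zero if the residual vanishes; then
    both sides are zero.\<close>
  also have "\<dots> = column j X \<bullet> ?e i"
    by (cases "gs_residual X i = 0") (auto simp: norm_sgn simp flip: power2_norm_eq_inner)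
  finally show ?case by simp
qed

lemma gram_schmidt_in_orth_group:
  assumes "\<And>j. gs_residual X j \<noteq> 0"
  shows "gram_schmidt X \<in> orth_group"
proof -
  have "sgn (gs_residual X i) \<bullet> sgn (gs_residual X j) = 0" if "i \<noteq> j" for i j
    using gs_residual_orthogonal[of i j X] gs_residual_orthogonal[of j i X] that
    by (cases i j rule: linorder_cases) (auto simp: sgn_div_norm inner_commute)
  then show ?thesis
    by (auto simp: orth_group_iff orthogonal_matrix_orthonormal_columns column_gram_schmidt
        orthogonal_def norm_sgn assms)
qed

lemma borel_measurable_gs_residual [measurable]:
  "(\<lambda>X. gs_residual X j) \<in> borel_measurable borel"
proof (induction j rule: finite_less_induct)
  case (1 j)
  have [measurable]: "(\<lambda>X. column j X) \<in> borel_measurable borel" for j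
    unfolding column_def by (intro borel_measurable_continuous_onI continuous_intros)
  have "(\<lambda>X. sgn (gs_residual X i)) \<in> borel_measurable borel" if "i < j" for i
    using 1[OF that] unfolding sgn_div_norm by measurable
  then show ?case
    by (subst gs_residual.simps)
      (intro borel_measurable_diff borel_measurable_sum borel_measurable_scaleR borel_measurable_inner; simp)
qed

lemma borel_measurable_gram_schmidt [measurable]: "gram_schmidt \<in> borel_measurable borel"
proof (subst borel_measurable_euclidean_space, intro ballI)
  fix B :: "real^'n::{finite,linorder}^'n::{finite,linorder}" assume "B \<in> Basis"
  have "gram_schmidt X \<bullet> B = (\<Sum>j\<in>UNIV. sgn (gs_residual X j) \<bullet> column j B)" for X :: "real^'n::{finite,linorder}^'n::{finite,linorder}"
    by (simp add: inner_matrix_columns column_gram_schmidt)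
  then show "(\<lambda>X. gram_schmidt X \<bullet> B) \<in> borel_measurable borel"
    by (simp add: sgn_div_norm)
qed

lemma gs_residual_mat_1:
  "gs_residual (mat 1 :: real^'n::{finite,linorder}^'n::{finite,linorder}) j = axis j 1"
proof (induction j rule: finite_less_induct)
  case (1 j)
  have col: "column j (mat 1 :: real^'n::{finite,linorder}^'n::{finite,linorder}) = axis j 1" for j
    by (auto simp: column_def mat_def axis_def vec_eq_iff)
  show ?case
    by (subst gs_residual.simps) (auto simp: 1 col inner_axis_axis sgn_div_norm intro!: sum.neutral)
qed

text \<open>The residuals of the identity are unit vectors, and \<open>sgn\<close> is continuous
  away from zero. Hence the residuals stay nonzero on a whole ball around the identity, which has
  positive Lebesgue measure.\<close>

lemma isCont_gs_residual_mat_1: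
  "isCont (\<lambda>X. gs_residual X j) (mat 1 :: real^'n::{finite,linorder}^'n::{finite,linorder})"
proof (induction j rule: finite_less_induct)
  case (1 j)
  have col: "isCont (\<lambda>X. column j X) (mat 1 :: real^'n::{finite,linorder}^'n::{finite,linorder})" for j
  proof -
    have "continuous_on UNIV (\<lambda>X :: real^'n::{finite,linorder}^'n::{finite,linorder}. column j X)"
      unfolding column_def by (intro continuous_intros)
    then show ?thesis by (simp add: continuous_on_eq_continuous_at)
  qed
  have "isCont (\<lambda>X. sgn (gs_residual X i)) (mat 1 :: real^'n::{finite,linorder}^'n::{finite,linorder})" if "i < j" for i
    using 1[OF that] by (intro continuous_intros) (auto simp: gs_residual_mat_1 axis_eq_0_iff)
  then show ?case
    by (subst gs_residual.simps)
      (intro continuous_diff continuous_sum continuous_scaleR continuous_inner col; simp)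
qed

lemma eventually_gs_residual_nonzero:
  "eventually (\<lambda>X. \<forall>j. gs_residual X j \<noteq> 0) (nhds (mat 1 :: real^'n::{finite,linorder}^'n::{finite,linorder}))"
proof (rule eventually_all_finite)
  fix j
  have "((\<lambda>X. gs_residual X j) \<longlongrightarrow> axis j 1) (nhds (mat 1 :: real^'n::{finite,linorder}^'n::{finite,linorder}))"
    using isCont_gs_residual_mat_1[of j] by (simp add: isCont_def gs_residual_mat_1 tendsto_nhds_iff)
  then show "eventually (\<lambda>X. gs_residual X j \<noteq> 0) (nhds (mat 1 :: real^'n::{finite,linorder}^'n::{finite,linorder}))"
    by (rule tendsto_imp_eventually_ne) (simp add: axis_eq_0_iff)
qed

section \<open>Haar measure: uniqueness, transposition and existence\<close>

locale orth_haar = prob_space \<mu> for \<mu> :: "(real^'n^'n) measure" +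
  assumes sets_haar [measurable_cong]: "sets \<mu> = sets borel"
    and mass_orth_group: "emeasure \<mu> orth_group = 1"
    and left_invariant: "Q \<in> orth_group \<Longrightarrow> distr \<mu> borel (\<lambda>U. Q ** U) = \<mu>"
begin

lemma AE_orth_group: "AE U in \<mu>. U \<in> orth_group"
  using mass_orth_group by (intro AE_I_eq_1) (simp_all add: sets_eq_imp_space_eq[OF sets_haar])

end

lemma borel_measurable_orth_mult [measurable]: "(\<lambda>X :: real^'m^'n. Q ** X) \<in> borel_measurable borel"
  by (intro borel_measurable_continuous_onI continuous_intros)

lemma borel_measurable_transpose [measurable]: "(transpose :: real^'m^'n \<Rightarrow> _) \<in> borel_measurable borel"
  by (intro borel_measurable_continuous_onI continuous_on_transpose continuous_on_id)

lemma transpose_orth_group: "U \<in> orth_group \<Longrightarrow> transpose U \<in> orth_group"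
  by (simp add: orth_group_iff)

text \<open>Integrate the indicator of \<open>A\<close> at \<open>transpose V ** U\<close> over both
  variables. For fixed \<open>V\<close>, invariance of \<open>\<mu>\<close> gives the
  \<open>\<mu>\<close>-measure of \<open>A\<close>; for fixed \<open>U\<close>, the argument is the
  transpose of \<open>transpose U ** V\<close>, and invariance of \<open>\<nu>\<close> gives the
  measure of \<open>A\<close> under the transposed \<open>\<nu>\<close>.\<close>

lemma orth_haar_unique_transpose:
  fixes \<mu> \<nu> :: "(real^'n^'n) measure"
  assumes "orth_haar \<mu>" "orth_haar \<nu>"
  shows "distr \<nu> borel transpose = \<mu>"
proof (rule measure_eqI)
  interpret \<mu>: orth_haar \<mu> by fact
  interpret \<nu>: orth_haar \<nu> by fact
  interpret pair_sigma_finite \<nu> \<mu> ..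
  note [measurable_cong] = \<mu>.sets_haar \<nu>.sets_haar
  show "sets (distr \<nu> borel transpose) = sets \<mu>"
    by (simp add: \<mu>.sets_haar)
  fix A assume "A \<in> sets (distr \<nu> borel transpose)"
  then have A [measurable]: "A \<in> sets borel" by simp
  define K where "K = (\<lambda>V U. indicator A (transpose V ** (U :: real^'n^'n)) :: ennreal)"
  have "emeasure \<mu> A = (\<integral>\<^sup>+V. emeasure \<mu> A \<partial>\<nu>)"
    by (simp add: \<nu>.emeasure_space_1)
  also have "\<dots> = (\<integral>\<^sup>+V. \<integral>\<^sup>+U. K V U \<partial>\<mu> \<partial>\<nu>)"
  proof (rule nn_integral_cong_AE, use \<nu>.AE_orth_group in eventually_elim)
    fix V :: "real^'n^'n" assume V: "V \<in> orth_group"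
    have "emeasure \<mu> A = (\<integral>\<^sup>+U. indicator A U \<partial>distr \<mu> borel (\<lambda>U. transpose V ** U))"
      by (simp add: \<mu>.left_invariant transpose_orth_group V)
    also have "\<dots> = (\<integral>\<^sup>+U. K V U \<partial>\<mu>)"
      unfolding K_def by (rule nn_integral_distr) measurable
    finally show "emeasure \<mu> A = (\<integral>\<^sup>+U. K V U \<partial>\<mu>)" .
  qed
  also have "\<dots> = (\<integral>\<^sup>+U. \<integral>\<^sup>+V. K V U \<partial>\<nu> \<partial>\<mu>)"
  proof (rule Fubini'[symmetric])
    have [measurable]: "(\<lambda>(V, U). transpose V ** U) \<in> borel_measurable (borel \<Otimes>\<^sub>M borel :: ((real^'n^'n) \<times> (real^'n^'n)) measure)"
      unfolding borel_prod case_prod_beta by (intro borel_measurable_continuous_onI continuous_intros)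
    show "(\<lambda>(V, U). K V U) \<in> borel_measurable (\<nu> \<Otimes>\<^sub>M \<mu>)"
      unfolding K_def by measurable
  qed
  also have "\<dots> = (\<integral>\<^sup>+U. emeasure (distr \<nu> borel transpose) A \<partial>\<mu>)"
  proof (rule nn_integral_cong_AE, use \<mu>.AE_orth_group in eventually_elim)
    fix U :: "real^'n^'n" assume U: "U \<in> orth_group"
    have "emeasure (distr \<nu> borel transpose) A = (\<integral>\<^sup>+V. indicator A (transpose V) \<partial>\<nu>)"
      by (subst nn_integral_distr[symmetric, where f = "indicator A" and M' = borel]) auto
    also have "\<dots> = (\<integral>\<^sup>+V. indicator A (transpose V) \<partial>distr \<nu> borel (\<lambda>V. transpose U ** V))"
      by (simp add: \<nu>.left_invariant transpose_orth_group U)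
    also have "\<dots> = (\<integral>\<^sup>+V. K V U \<partial>\<nu>)"
      unfolding K_def by (subst nn_integral_distr) (auto simp: matrix_transpose_mul)
    finally show "(\<integral>\<^sup>+V. K V U \<partial>\<nu>) = emeasure (distr \<nu> borel transpose) A" by simp
  qed
  also have "\<dots> = emeasure (distr \<nu> borel transpose) A"
    by (simp add: \<mu>.emeasure_space_1)
  finally show "emeasure (distr \<nu> borel transpose) A = emeasure \<mu> A" by simp
qed

text \<open>Restricting Lebesgue measure to a bounded invariant set on which the Gram--Schmidt
  residuals do not vanish spares us from proving that singular matrices form a null set.\<close>

lemma orth_haar_exists:
  "\<exists>\<mu> :: (real^'n::{finite,linorder}^'n::{finite,linorder}) measure. orth_haar \<mu>"
proof -
  define R where "R = norm (mat 1 :: real^'n::{finite,linorder}^'n::{finite,linorder}) + 1"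
  define B where "B = {X :: real^'n::{finite,linorder}^'n::{finite,linorder}. norm X < R \<and> (\<forall>j. gs_residual X j \<noteq> 0)}"
  have [measurable]: "B \<in> sets borel" unfolding B_def by measurable
  have "eventually (\<lambda>X. norm X < R) (nhds (mat 1 :: real^'n::{finite,linorder}^'n::{finite,linorder}))"
    unfolding R_def by (rule order_tendstoD(2)[OF tendsto_norm[OF filterlim_ident]]) simp
  then have "eventually (\<lambda>X. X \<in> B) (nhds (mat 1))"
    using eventually_gs_residual_nonzero unfolding B_def by eventually_elim simp
  then obtain r where "r > 0" and r: "ball (mat 1) r \<subseteq> B"
    by (auto simp: eventually_nhds_metric dist_commute subset_eq)
  have "emeasure lborel (ball (mat 1 :: real^'n::{finite,linorder}^'n::{finite,linorder}) r) \<noteq> 0"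
    using content_ball_pos[OF \<open>r > 0\<close>, of "mat 1 :: real^'n::{finite,linorder}^'n::{finite,linorder}"] by (auto simp: measure_def)
  then have B0: "emeasure lborel B \<noteq> 0"
    using emeasure_mono[OF r, of lborel] by auto
  have Bfin: "emeasure lborel B \<noteq> \<infinity>"
  proof -
    have "bounded B"
      by (rule boundedI[of _ R]) (auto simp: B_def)
    from emeasure_bounded_finite[OF this] show ?thesis by simp
  qed
  define L where "L = uniform_measure lborel B"
  define \<mu> where "\<mu> = distr L borel gram_schmidt"
  have [measurable_cong]: "sets L = sets borel" by (simp add: L_def)
  interpret L: prob_space L
    unfolding L_def using B0 Bfin by (intro prob_space_uniform_measure) auto
  have L_invariant: "distr L borel (\<lambda>X. Q ** X) = L" if Q: "Q \<in> orth_group" for Q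
  proof (rule measure_eqI)
    fix A assume "A \<in> sets (distr L borel (\<lambda>X. Q ** X))"
    then have A [measurable]: "A \<in> sets borel" by simp
    \<comment> \<open>Both conditions defining \<open>B\<close> survive left multiplication by
      \<open>Q\<close>, so the uniform measure on \<open>B\<close> inherits the invariance of
      Lebesgue measure.\<close>
    have BQ: "(\<lambda>X. Q ** X) -` B = B"
    proof -
      have "Q *v x = 0 \<longleftrightarrow> x = 0" for x
        by (metis Q norm_eq_zero norm_orth_mult_vec)
      then show ?thesis
        by (simp add: B_def norm_orth_mult[OF Q] gs_residual_equivariant[OF Q])
    qed
    have "emeasure (distr L borel (\<lambda>X. Q ** X)) A = emeasure L ((\<lambda>X. Q ** X) -` A)"
      by (subst emeasure_distr) (auto simp: L_def)
    also have "\<dots> = emeasure lborel ((\<lambda>X. Q ** X) -` (B \<inter> A)) / emeasure lborel B"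
      using BQ measurable_sets_borel[OF borel_measurable_orth_mult A, of Q] by (simp add: L_def)
    also have "emeasure lborel ((\<lambda>X. Q ** X) -` (B \<inter> A)) = emeasure (distr lborel borel (\<lambda>X. Q ** X)) (B \<inter> A)"
      by (subst emeasure_distr) auto
    also have "\<dots> = emeasure lborel (B \<inter> A)"
      by (simp add: lborel_distr_orthogonal_transformation orthogonal_transformation_orth_mult Q)
    also have "\<dots> / emeasure lborel B = emeasure L A"
      by (simp add: L_def)
    finally show "emeasure (distr L borel (\<lambda>X. Q ** X)) A = emeasure L A" .
  qed (simp add: L_def)
  interpret \<mu>: prob_space \<mu>
    unfolding \<mu>_def by (rule L.prob_space_distr) measurable
  have "orth_haar \<mu>"
  proof
    show "sets \<mu> = sets borel" by (simp add: \<mu>_def)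
    have "AE X in L. X \<in> B"
      unfolding L_def by (rule AE_uniform_measureI) auto
    then have "AE X in L. gram_schmidt X \<in> orth_group"
      by eventually_elim (auto simp: B_def intro: gram_schmidt_in_orth_group)
    then have "AE U in \<mu>. U \<in> orth_group"
      unfolding \<mu>_def by (subst AE_distr_iff) auto
    then show "emeasure \<mu> orth_group = 1"
      by (subst \<mu>.emeasure_eq_1_AE) (auto simp: \<mu>_def)
    fix Q :: "real^'n::{finite,linorder}^'n::{finite,linorder}" assume Q: "Q \<in> orth_group"
    have "distr \<mu> borel (\<lambda>U. Q ** U) = distr L borel (\<lambda>X. Q ** gram_schmidt X)"
      unfolding \<mu>_def by (subst distr_distr) (auto simp: comp_def)
    also have "\<dots> = distr L borel (\<lambda>X. gram_schmidt (Q ** X))"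
      by (simp add: gram_schmidt_equivariant Q)
    also have "\<dots> = distr (distr L borel (\<lambda>X. Q ** X)) borel gram_schmidt"
      by (subst distr_distr) (auto simp: comp_def)
    also have "\<dots> = \<mu>"
      by (simp add: L_invariant Q \<mu>_def)
    finally show "distr \<mu> borel (\<lambda>U. Q ** U) = \<mu>" .
  qed
  then show ?thesis ..
qed

text \<open>Both measures equal the transposed \<open>\<nu>\<close>.\<close>

lemma orth_haar_unique:
  assumes "orth_haar \<mu>" "orth_haar \<nu>"
  shows "\<mu> = \<nu>"
  using orth_haar_unique_transpose[OF assms] orth_haar_unique_transpose[OF assms(2,2)] by simp

lemma orth_haar_haar_orth:
  "orth_haar (haar_orth :: (real^'n::{finite,linorder}^'n::{finite,linorder}) measure)"
proof -
  have eq: "orth_haar \<mu> \<longleftrightarrow> (sets \<mu> = sets borel \<and> prob_space \<mu> \<and> emeasure \<mu> orth_group = 1 \<and>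
       (\<forall>Q\<in>orth_group. distr \<mu> borel (\<lambda>U. Q ** U) = \<mu>))" for \<mu> :: "(real^'n::{finite,linorder}^'n::{finite,linorder}) measure"
    by (auto simp: orth_haar_def orth_haar_axioms_def)
  have "\<exists>!\<mu> :: (real^'n::{finite,linorder}^'n::{finite,linorder}) measure. orth_haar \<mu>"
    using orth_haar_exists orth_haar_unique by blast
  from theI'[OF this] show ?thesis
    unfolding haar_orth_def eq[symmetric] .
qed

section \<open>Plane rotations and auxiliary facts for comparing moments\<close>

definition plane_rotation :: "'n::finite \<Rightarrow> 'n \<Rightarrow> real \<Rightarrow> real \<Rightarrow> real^'n^'n" where
  "plane_rotation i j c s = (\<chi> k m.
     if k = i then (if m = i then c else 0) + (if m = j then s else 0)
     else if k = j then (if m = i then - s else 0) + (if m = j then c else 0)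
     else if m = k then 1 else 0)"

lemma plane_rotation_mult:
  "(plane_rotation i j c s ** U) $ k $ l =
     (if k = i then c * U $ i $ l + s * U $ j $ l
      else if k = j then - s * U $ i $ l + c * U $ j $ l
      else U $ k $ l)"
  by (simp add: plane_rotation_def matrix_matrix_mult_def distrib_right sum.distrib
      if_distrib[of "\<lambda>x. x * _"] cong: if_cong)

lemma plane_rotation_in_orth_group:
  assumes "i \<noteq> j" "c\<^sup>2 + s\<^sup>2 = 1"
  shows "plane_rotation i j c s \<in> orth_group"
proof -
  \<comment> \<open>In this order \<open>plane_rotation_mult\<close> computes the product; for
    square matrices the other order follows.\<close>
  have "plane_rotation i j c s ** transpose (plane_rotation i j c s) = mat 1"
    unfolding vec_eq_iff plane_rotation_mult
    using assms by (auto simp: transpose_def plane_rotation_def mat_def power2_eq_square)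
  then show ?thesis
    unfolding orth_group_def by (simp add: matrix_left_right_inverse)
qed

lemma coeff_one_plus_square_power:
  fixes m :: nat
  shows "coeff ([:1, 0, 1 :: real:] ^ m) 0 = 1" "coeff ([:1, 0, 1 :: real:] ^ m) 2 = real m"
proof -
  have "coeff ([:1, 0, 1 :: real:] ^ m) 0 = 1 \<and> coeff ([:1, 0, 1 :: real:] ^ m) 2 = real m"
    by (induction m) (auto simp: numeral_2_eq_2)
  then show "coeff ([:1, 0, 1 :: real:] ^ m) 0 = 1" "coeff ([:1, 0, 1 :: real:] ^ m) 2 = real m"
    by auto
qed

lemma column_sum_squares:
  assumes "U \<in> orth_group"
  shows "(\<Sum>j\<in>UNIV. (U $ j $ l)\<^sup>2) = 1"
proof -
  have "(transpose U ** U) $ l $ l = 1"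
    using assms by (simp add: orth_group_def mat_def)
  then show ?thesis
    by (simp add: matrix_matrix_mult_def transpose_def power2_eq_square)
qed

lemma dfact_pos [simp]: "dfact m > 0"
  by (induction m rule: dfact.induct) auto

lemma dfact_neq_0 [simp]: "dfact m \<noteq> 0"
  using dfact_pos[of m] by simp

lemma dfact_add2: "dfact (m + 2) = (m + 1) * dfact m"
  by simp

section \<open>Moments of matrix entries under Haar measure\<close>

context orth_haar
begin

text \<open>The measure is concentrated on a compact set, where \<open>h\<close> is bounded.\<close>

lemma integrable_continuous:
  fixes h :: "real^'n^'n \<Rightarrow> real"
  assumes "continuous_on UNIV h"
  shows "integrable \<mu> h"
proof -
  have "bounded (h ` orth_group)"
    using assms by (intro compact_imp_bounded compact_continuous_image compact_orth_group)
      (rule continuous_on_subset, auto)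
  then obtain C where C: "\<And>U. U \<in> orth_group \<Longrightarrow> norm (h U) \<le> C"
    by (auto simp: bounded_iff)
  have [measurable]: "h \<in> borel_measurable borel"
    using assms by (rule borel_measurable_continuous_onI)
  show ?thesis
  proof (rule integrable_const_bound)
    show "AE U in \<mu>. norm (h U) \<le> C"
      using AE_orth_group by eventually_elim (rule C)
  qed measurable
qed

lemma integral_left_mult:
  fixes h :: "real^'n^'n \<Rightarrow> real"
  assumes "Q \<in> orth_group" "continuous_on UNIV h"
  shows "(\<integral>U. h (Q ** U) \<partial>\<mu>) = (\<integral>U. h U \<partial>\<mu>)"
proof -
  have [measurable]: "h \<in> borel_measurable borel"
    using assms(2) by (rule borel_measurable_continuous_onI)
  have "(\<integral>U. h U \<partial>\<mu>) = (\<integral>U. h U \<partial>distr \<mu> borel (\<lambda>U. Q ** U))"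
    by (simp add: left_invariant assms)
  also have "\<dots> = (\<integral>U. h (Q ** U) \<partial>\<mu>)"
    by (rule integral_distr) measurable
  finally show ?thesis ..
qed

lemma integral_transpose:
  fixes h :: "real^'n^'n \<Rightarrow> real"
  assumes "continuous_on UNIV h"
  shows "(\<integral>U. h (transpose U) \<partial>\<mu>) = (\<integral>U. h U \<partial>\<mu>)"
proof -
  have [measurable]: "h \<in> borel_measurable borel"
    using assms by (rule borel_measurable_continuous_onI)
  have "(\<integral>U. h U \<partial>\<mu>) = (\<integral>U. h U \<partial>distr \<mu> borel transpose)"
    by (simp only: orth_haar_unique_transpose[OF orth_haar_axioms orth_haar_axioms])
  also have "\<dots> = (\<integral>U. h (transpose U) \<partial>\<mu>)"
    by (rule integral_distr) measurable
  finally show ?thesis ..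
qed

text \<open>Rotating rows \<open>i\<close> and \<open>j\<close> by the angle with tangent \<open>t\<close> shows that
  \<open>\<integral> g (u\<^sub>i + t u\<^sub>j) ^ N = (1 + t\<^sup>2) ^ (N / 2) \<integral> g u\<^sub>i ^ N\<close>; the recurrence is the
  coefficient of \<open>t\<^sup>2\<close>.\<close>

lemma rotation_recurrence:
  fixes g :: "real^'n^'n \<Rightarrow> real"
  assumes ij: "i \<noteq> j" and g: "continuous_on UNIV g"
    and g_dep: "\<And>U V. (\<And>k. k \<noteq> i \<Longrightarrow> k \<noteq> j \<Longrightarrow> U $ k = V $ k) \<Longrightarrow> g U = g V"
  shows "(\<integral>U. g U * (U $ i $ l) ^ (2 * p + 2) \<partial>\<mu>)
       = real (2 * p + 1) * (\<integral>U. g U * (U $ i $ l) ^ (2 * p) * (U $ j $ l)\<^sup>2 \<partial>\<mu>)"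
proof -
  define N where "N = 2 * p + 2"
  define A where "A = (\<lambda>k. \<integral>U. g U * (U $ i $ l) ^ (N - k) * (U $ j $ l) ^ k \<partial>\<mu>)"
  define P where "P = (\<Sum>k\<le>N. monom (real (N choose k) * A k) k)"
  have "poly P t = poly (smult (A 0) ([:1, 0, 1:] ^ (p + 1))) t" for t
  proof -
    \<comment> \<open>Dividing by \<open>w\<close> turns \<open>(1, t)\<close> into the cosine and
      sine of a rotation.\<close>
    define w where "w = sqrt (1 + t\<^sup>2)"
    have w2: "w\<^sup>2 = 1 + t\<^sup>2" and w: "w > 0"
      by (auto simp: w_def add_pos_nonneg)
    define Q :: "real^'n^'n" where "Q = plane_rotation i j (1 / w) (t / w)"
    have Q: "Q \<in> orth_group"
      unfolding Q_def using ij w w2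
      by (intro plane_rotation_in_orth_group) (auto simp: power_divide simp flip: add_divide_distrib)
    have gQ: "g (Q ** U) = g U" for U
      by (rule g_dep) (simp add: Q_def vec_eq_iff plane_rotation_mult)
    have QU: "(Q ** U) $ i $ l = (U $ i $ l + t * U $ j $ l) / w" for U
      by (simp add: Q_def plane_rotation_mult add_divide_distrib)
    have "A 0 = (\<integral>U. g U * (U $ i $ l) ^ N \<partial>\<mu>)"
      by (simp add: A_def)
    also have "\<dots> = (\<integral>U. g (Q ** U) * ((Q ** U) $ i $ l) ^ N \<partial>\<mu>)"
      by (rule integral_left_mult[symmetric, OF Q]) (intro continuous_intros g)
    also have "\<dots> = (\<integral>U. g U * (U $ i $ l + t * U $ j $ l) ^ N / w ^ N \<partial>\<mu>)"
      by (simp add: gQ QU power_divide)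
    finally have "A 0 * w ^ N = (\<integral>U. g U * (U $ i $ l + t * U $ j $ l) ^ N \<partial>\<mu>)"
      using w by simp
    also have "\<dots> = (\<integral>U. (\<Sum>k\<le>N. real (N choose k) * t ^ k * (g U * (U $ i $ l) ^ (N - k) * (U $ j $ l) ^ k)) \<partial>\<mu>)"
      by (subst add.commute, subst binomial_ring)
        (simp add: sum_distrib_left power_mult_distrib mult_ac)
    also have "\<dots> = (\<Sum>k\<le>N. real (N choose k) * t ^ k * A k)"
      unfolding A_def
      by (subst Bochner_Integration.integral_sum)
        (auto intro!: integrable_continuous continuous_intros g)
    also have "\<dots> = poly P t"
      by (simp add: P_def poly_sum poly_monom mult_ac)
    \<comment> \<open>\<open>N\<close> is even, so the square root disappears and both sides are
      polynomials in \<open>t\<close>.\<close>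
    also have "w ^ N = (1 + t\<^sup>2) ^ (p + 1)"
      unfolding w2[symmetric] power_mult[symmetric] by (simp add: N_def)
    finally show ?thesis
      by (simp add: poly_power power2_eq_square distrib_right mult.assoc)
  qed
  then have "P = smult (A 0) ([:1, 0, 1:] ^ (p + 1))"
    by (simp add: poly_eq_poly_eq_iff[symmetric] fun_eq_iff)
  then have "coeff P 2 = A 0 * real (p + 1)"
    by (simp only: coeff_smult coeff_one_plus_square_power)
  moreover have "coeff P 2 = real (N choose 2) * A 2"
  proof -
    have "2 \<le> N" by (simp add: N_def)
    then show ?thesis by (simp add: P_def coeff_sum)
  qed
  moreover have "real (N choose 2) = real (p + 1) * real (2 * p + 1)"
    by (simp add: choose_two N_def) (simp add: algebra_simps)
  ultimately have "real (p + 1) * A 0 = real (p + 1) * (real (2 * p + 1) * A 2)"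
    by (simp only: mult_ac)
  then have "A 0 = real (2 * p + 1) * A 2"
    by (subst (asm) mult_cancel_left) simp
  then show ?thesis
    by (simp add: A_def N_def)
qed

text \<open>Given the rows outside \<open>J\<close>, the entries of column \<open>l\<close> in the
  rows of \<open>J\<close> behave like a uniform point on a sphere whose squared radius is the
  bracket on the right. Summing \<open>rotation_recurrence\<close> over the other rows of
  \<open>J\<close> lowers the exponent by two and multiplies \<open>g\<close> by that bracket, so
  the induction must vary \<open>g\<close>.\<close>

lemma column_moment:
  fixes g :: "real^'n^'n \<Rightarrow> real"
  assumes i: "i \<in> J" and g: "continuous_on UNIV g"
    and g_dep: "\<And>U V. (\<And>k. k \<notin> J \<Longrightarrow> U $ k = V $ k) \<Longrightarrow> g U = g V"
  shows "(\<integral>U. g U * (U $ i $ l) ^ (2 * k) \<partial>\<mu>)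
       = real (dfact (2 * k)) * real (dfact (card J - 1)) / real (dfact (2 * k + (card J - 1)))
         * (\<integral>U. g U * (1 - (\<Sum>j\<in>-J. (U $ j $ l)\<^sup>2)) ^ k \<partial>\<mu>)"
  using g g_dep
proof (induction k arbitrary: g)
  case 0
  show ?case by simp
next
  case (Suc k)
  note g = Suc.prems(1) and g_dep = Suc.prems(2)
  define m where "m = card J - 1"
  define S where "S = (\<lambda>U :: real^'n^'n. 1 - (\<Sum>j\<in>-J. (U $ j $ l)\<^sup>2))"
  have S: "continuous_on UNIV S"
    unfolding S_def by (intro continuous_intros)
  have cJ: "card (J - {i}) = m"
    using i by (simp add: m_def)
  have "real m * (\<integral>U. g U * (U $ i $ l) ^ (2 * k + 2) \<partial>\<mu>)
      = (\<Sum>j\<in>J - {i}. \<integral>U. g U * (U $ i $ l) ^ (2 * k + 2) \<partial>\<mu>)"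
    by (simp add: cJ)
  also have "\<dots> = (\<Sum>j\<in>J - {i}. real (2 * k + 1) * (\<integral>U. g U * (U $ i $ l) ^ (2 * k) * (U $ j $ l)\<^sup>2 \<partial>\<mu>))"
  proof (rule sum.cong[OF refl])
    fix j assume j: "j \<in> J - {i}"
    then have ij: "i \<noteq> j" by auto
    have dep: "g U = g V" if eq: "\<And>k. k \<noteq> i \<Longrightarrow> k \<noteq> j \<Longrightarrow> U $ k = V $ k" for U V
    proof (rule g_dep)
      fix k assume "k \<notin> J"
      with i j have "k \<noteq> i" "k \<noteq> j" by auto
      then show "U $ k = V $ k" by (rule eq)
    qed
    show "(\<integral>U. g U * (U $ i $ l) ^ (2 * k + 2) \<partial>\<mu>)
        = real (2 * k + 1) * (\<integral>U. g U * (U $ i $ l) ^ (2 * k) * (U $ j $ l)\<^sup>2 \<partial>\<mu>)"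
      by (rule rotation_recurrence[OF ij g dep])
  qed
  also have "\<dots> = real (2 * k + 1) * (\<integral>U. (\<Sum>j\<in>J - {i}. g U * (U $ i $ l) ^ (2 * k) * (U $ j $ l)\<^sup>2) \<partial>\<mu>)"
    by (subst Bochner_Integration.integral_sum)
      (auto intro!: integrable_continuous continuous_intros g simp: sum_distrib_left)
  \<comment> \<open>Unit columns hold only on \<open>orth_group\<close>, hence almost
    everywhere.\<close>
  also have "(\<integral>U. (\<Sum>j\<in>J - {i}. g U * (U $ i $ l) ^ (2 * k) * (U $ j $ l)\<^sup>2) \<partial>\<mu>)
      = (\<integral>U. g U * S U * (U $ i $ l) ^ (2 * k) - g U * (U $ i $ l) ^ (2 * k + 2) \<partial>\<mu>)"
  proof (rule integral_cong_AE)
    show "AE U in \<mu>. (\<Sum>j\<in>J - {i}. g U * (U $ i $ l) ^ (2 * k) * (U $ j $ l)\<^sup>2)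
        = g U * S U * (U $ i $ l) ^ (2 * k) - g U * (U $ i $ l) ^ (2 * k + 2)"
      using AE_orth_group
    proof eventually_elim
      fix U :: "real^'n^'n" assume "U \<in> orth_group"
      then have "1 = (\<Sum>j\<in>J. (U $ j $ l)\<^sup>2) + (\<Sum>j\<in>-J. (U $ j $ l)\<^sup>2)"
        by (subst column_sum_squares[symmetric, of U l], simp, subst sum.union_disjoint[symmetric]) auto
      also have "(\<Sum>j\<in>J. (U $ j $ l)\<^sup>2) = (U $ i $ l)\<^sup>2 + (\<Sum>j\<in>J - {i}. (U $ j $ l)\<^sup>2)"
        using i by (simp add: sum.remove)
      finally have "(\<Sum>j\<in>J - {i}. (U $ j $ l)\<^sup>2) = S U - (U $ i $ l)\<^sup>2"
        by (simp add: S_def)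
      then show "(\<Sum>j\<in>J - {i}. g U * (U $ i $ l) ^ (2 * k) * (U $ j $ l)\<^sup>2)
        = g U * S U * (U $ i $ l) ^ (2 * k) - g U * (U $ i $ l) ^ (2 * k + 2)"
        unfolding sum_distrib_left[symmetric] 
        by (simp add: right_diff_distrib power_add power2_eq_square mult_ac)
    qed
    show "(\<lambda>U. \<Sum>j\<in>J - {i}. g U * (U $ i $ l) ^ (2 * k) * (U $ j $ l)\<^sup>2) \<in> borel_measurable \<mu>"
      by (rule borel_measurable_integrable, rule integrable_continuous) (intro continuous_intros g)
    show "(\<lambda>U. g U * S U * (U $ i $ l) ^ (2 * k) - g U * (U $ i $ l) ^ (2 * k + 2)) \<in> borel_measurable \<mu>"
      by (rule borel_measurable_integrable, rule integrable_continuous) (intro continuous_intros g S)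
  qed
  also have "\<dots> = (\<integral>U. g U * S U * (U $ i $ l) ^ (2 * k) \<partial>\<mu>) - (\<integral>U. g U * (U $ i $ l) ^ (2 * k + 2) \<partial>\<mu>)"
    by (rule Bochner_Integration.integral_diff; rule integrable_continuous) (intro continuous_intros g S)+
  \<comment> \<open>The subtracted integral moves to the left and adds \<open>2 * k + 1\<close> to
    the factor \<open>m\<close>.\<close>
  finally have "real (2 * k + m + 1) * (\<integral>U. g U * (U $ i $ l) ^ (2 * k + 2) \<partial>\<mu>)
      = real (2 * k + 1) * (\<integral>U. g U * S U * (U $ i $ l) ^ (2 * k) \<partial>\<mu>)"
    by (simp add: algebra_simps)
  then have "(\<integral>U. g U * (U $ i $ l) ^ (2 * k + 2) \<partial>\<mu>)
      = real (2 * k + 1) / real (2 * k + m + 1) * (\<integral>U. (g U * S U) * (U $ i $ l) ^ (2 * k) \<partial>\<mu>)"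
    by (simp add: field_simps del: of_nat_Suc of_nat_add)
  also have "(\<integral>U. (g U * S U) * (U $ i $ l) ^ (2 * k) \<partial>\<mu>)
      = real (dfact (2 * k)) * real (dfact m) / real (dfact (2 * k + m)) * (\<integral>U. (g U * S U) * S U ^ k \<partial>\<mu>)"
    \<comment> \<open>\<open>S\<close> depends only on the rows outside \<open>J\<close>, so the
      induction hypothesis applies to the product of \<open>g\<close> and \<open>S\<close>.\<close>
    unfolding m_def S_def
  proof (rule Suc.IH)
    fix U V :: "real^'n^'n" assume eq: "\<And>k. k \<notin> J \<Longrightarrow> U $ k = V $ k"
    then show "g U * (1 - (\<Sum>j\<in>-J. (U $ j $ l)\<^sup>2)) = g V * (1 - (\<Sum>j\<in>-J. (V $ j $ l)\<^sup>2))"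
      using g_dep[of U V] by simp
  qed (intro continuous_intros g)
  also have "real (2 * k + 1) / real (2 * k + m + 1) * \<dots>
      = real ((2 * k + 1) * dfact (2 * k)) * real (dfact m) / real ((2 * k + m + 1) * dfact (2 * k + m))
        * (\<integral>U. g U * S U ^ Suc k \<partial>\<mu>)"
    unfolding of_nat_mult by (simp add: mult.assoc del: of_nat_add of_nat_Suc)
  also have "(2 * k + 1) * dfact (2 * k) = dfact (2 * Suc k)"
    by simp
  also have "(2 * k + m + 1) * dfact (2 * k + m) = dfact (2 * Suc k + m)"
    by simp
  finally show ?case
    by (simp add: m_def S_def)
qed

text \<open>A Beta integral in double factorials. The base case is \<open>column_moment\<close> with
  all rows in \<open>J\<close>; the step splits off one factor \<open>1 - u^2\<close>, whose second
  term raises \<open>k\<close>, so \<open>k\<close> must vary.\<close>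

lemma entry_moment:
  assumes n: "CARD('n) \<ge> 2"
  shows "(\<integral>U. (U $ i $ l) ^ (2 * k) * (1 - (U $ i $ l)\<^sup>2) ^ q \<partial>\<mu>)
     = real (dfact (2 * k)) * real (dfact (2 * q + CARD('n) - 2)) * real (dfact (CARD('n) - 1))
       / (real (dfact (CARD('n) - 2)) * real (dfact (2 * k + 2 * q + CARD('n) - 1)))"
proof -
  obtain n where n: "CARD('n) = n + 2"
    using n by (metis add.commute le_Suc_ex)
  show ?thesis
  proof (induction q arbitrary: k)
    case 0
    show ?case
      using column_moment[of i UNIV "\<lambda>_. 1" l k] by (simp add: n prob_space)
  next
    case (Suc q)
    let ?u = "\<lambda>U :: real^'n^'n. U $ i $ l"
    have "(\<integral>U. ?u U ^ (2 * k) * (1 - (?u U)\<^sup>2) ^ Suc q \<partial>\<mu>)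
        = (\<integral>U. ?u U ^ (2 * k) * (1 - (?u U)\<^sup>2) ^ q - ?u U ^ (2 * Suc k) * (1 - (?u U)\<^sup>2) ^ q \<partial>\<mu>)"
      by (simp add: algebra_simps power2_eq_square)
    also have "\<dots> = (\<integral>U. ?u U ^ (2 * k) * (1 - (?u U)\<^sup>2) ^ q \<partial>\<mu>) - (\<integral>U. ?u U ^ (2 * Suc k) * (1 - (?u U)\<^sup>2) ^ q \<partial>\<mu>)"
      by (intro Bochner_Integration.integral_diff integrable_continuous continuous_intros)
    also have "\<dots> = real (dfact (2 * k)) * real (dfact (2 * Suc q + CARD('n) - 2)) * real (dfact (CARD('n) - 1))
       / (real (dfact (CARD('n) - 2)) * real (dfact (2 * k + 2 * Suc q + CARD('n) - 1)))"
    proof -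
      \<comment> \<open>\<open>Y\<close>, \<open>r\<close> and \<open>s\<close> are the factors
        gained when the double factorials in the total exponent, in \<open>k\<close> and in
        \<open>q\<close> advance by two. The recurrence reduces to
        \<open>1 - r / Y = s / Y\<close>.\<close>
      define X Y r s where "X = real (dfact (2 * k + 2 * q + n + 1))"
        and "Y = real (2 * k + 2 * q + n + 1 + 1)" and "r = real (2 * k + 1)" and "s = real (2 * q + n + 1)"
      have "X > 0" "Y > 0" "s = Y - r"
        by (simp_all add: X_def Y_def r_def s_def)
      then have combine: "A * B * C / (D * X) - (r * A) * B * C / (D * (Y * X)) = A * (s * B) * C / (D * (Y * X))"
        if "D > 0" for A B C D :: real
        using that by (simp add: divide_simps) (simp add: algebra_simps)
      have e: "2 * k + 2 + 2 * q + (n + 2) - 1 = (2 * k + 2 * q + n + 1) + 2"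
        "2 * k + (2 * q + 2) + (n + 2) - 1 = (2 * k + 2 * q + n + 1) + 2"
        "2 * k + 2 * q + (n + 2) - 1 = 2 * k + 2 * q + n + 1"
        "2 * q + 2 + (n + 2) - 2 = (2 * q + n) + 2" "2 * q + (n + 2) - 2 = 2 * q + n"
        by auto
      have double_Suc: "2 * Suc m = 2 * m + 2" for m
        by simp
      show ?thesis
        unfolding Suc.IH
        unfolding n double_Suc
        unfolding e dfact_add2 of_nat_mult X_def[symmetric] Y_def[symmetric] r_def[symmetric] s_def[symmetric]
        by (rule combine) simp
    qed
    finally show ?case .
  qed
qed

end

section \<open>Evaluation of the integral\<close>

lemma fact_eq_dfact: "fact n = dfact (Suc n) * dfact n"
  by (induction n) (simp_all add: algebra_simps)

lemma idx_neq: "CARD('n::{finite,linorder}) \<ge> 2 \<Longrightarrow> (idx2 :: 'n) \<noteq> idx1"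
proof -
  assume "CARD('n) \<ge> 2"
  then have "UNIV - {idx1 :: 'n} \<noteq> {}"
    using card_mono[of "{idx1 :: 'n}" UNIV] by auto
  from Min_in[OF _ this] show ?thesis
    unfolding idx2_def by auto
qed

lemma Iint_corner:
  assumes n: "CARD('n::{finite,linorder}) = n + 2"
  shows "Iint TYPE('n) (2 * a) (2 * c) (2 * b) 0 =
    real (fact n) * real (dfact (2 * a)) * real (dfact (2 * b)) * real (dfact (2 * c)) * real (dfact (2 * b + 2 * c + n))
    / (real (dfact (2 * b + n)) * real (dfact (2 * c + n)) * real (dfact (2 * a + 2 * b + 2 * c + n + 1)))"
proof -
  define \<mu> where "\<mu> = (haar_orth :: (real^'n::{finite,linorder}^'n::{finite,linorder}) measure)"
  interpret orth_haar \<mu>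
    unfolding \<mu>_def by (rule orth_haar_haar_orth)
  let ?i = "idx1 :: 'n" and ?j = "idx2 :: 'n"
  have ij: "?j \<noteq> ?i" by (rule idx_neq) (simp add: n)
  have card: "card (- {?i}) - 1 = n" by (simp add: Compl_eq_Diff_UNIV n)
  \<comment> \<open>This is \<open>column_moment\<close> with \<open>J\<close> consisting of all
    rows but the first: the sum over the complement is the single square of the corner
    entry.\<close>
  have moment: "(\<integral>U. g U * (U $ ?j $ ?i) ^ (2 * k) \<partial>\<mu>)
       = real (dfact (2 * k)) * real (dfact n) / real (dfact (2 * k + n))
         * (\<integral>U. g U * (1 - (U $ ?i $ ?i)\<^sup>2) ^ k \<partial>\<mu>)"
    if g: "continuous_on UNIV g" and g_dep: "\<And>U V. U $ ?i = V $ ?i \<Longrightarrow> g U = g V" for g k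
  proof -
    have j: "?j \<in> - {?i}" using ij by simp
    have dep: "g U = g V" if "\<And>k. k \<notin> - {?i} \<Longrightarrow> U $ k = V $ k" for U V
      by (rule g_dep) (simp add: that)
    show ?thesis
      using column_moment[OF j g dep, of ?i k] unfolding card by simp
  qed
  have "Iint TYPE('n) (2 * a) (2 * c) (2 * b) 0
      = (\<integral>U. (U $ ?i $ ?i) ^ (2 * a) * (U $ ?i $ ?j) ^ (2 * c) * (U $ ?j $ ?i) ^ (2 * b) \<partial>\<mu>)"
    by (simp add: Iint_def \<mu>_def)
  also have "\<dots> = real (dfact (2 * b)) * real (dfact n) / real (dfact (2 * b + n))
      * (\<integral>U. (U $ ?i $ ?i) ^ (2 * a) * (U $ ?i $ ?j) ^ (2 * c) * (1 - (U $ ?i $ ?i)\<^sup>2) ^ b \<partial>\<mu>)"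
    by (rule moment) (auto intro!: continuous_intros)
  also have "(\<integral>U. (U $ ?i $ ?i) ^ (2 * a) * (U $ ?i $ ?j) ^ (2 * c) * (1 - (U $ ?i $ ?i)\<^sup>2) ^ b \<partial>\<mu>)
      = (\<integral>U. (U $ ?i $ ?i) ^ (2 * a) * (1 - (U $ ?i $ ?i)\<^sup>2) ^ b * (U $ ?j $ ?i) ^ (2 * c) \<partial>\<mu>)"
    \<comment> \<open>Transposition fixes the corner entry and moves the remaining first-row entry
      to the second row, where \<open>moment\<close> applies again.\<close>
    by (subst integral_transpose[symmetric]) (auto intro!: continuous_intros simp: transpose_def mult_ac)
  also have "\<dots> = real (dfact (2 * c)) * real (dfact n) / real (dfact (2 * c + n))
      * (\<integral>U. (U $ ?i $ ?i) ^ (2 * a) * (1 - (U $ ?i $ ?i)\<^sup>2) ^ b * (1 - (U $ ?i $ ?i)\<^sup>2) ^ c \<partial>\<mu>)"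
    by (rule moment) (auto intro!: continuous_intros)
  also have "(\<integral>U. (U $ ?i $ ?i) ^ (2 * a) * (1 - (U $ ?i $ ?i)\<^sup>2) ^ b * (1 - (U $ ?i $ ?i)\<^sup>2) ^ c \<partial>\<mu>)
      = real (dfact (2 * a)) * real (dfact (2 * b + 2 * c + n)) * real (dfact (n + 1))
       / (real (dfact n) * real (dfact (2 * a + 2 * b + 2 * c + n + 1)))"
    using entry_moment[of ?i ?i a "b + c"] by (simp add: n power_add mult.assoc add.assoc algebra_simps)
  \<comment> \<open>The leftover constant \<open>dfact n * dfact (n + 1)\<close> collects the
    numbers up to \<open>n\<close> of both parities, hence is \<open>fact n\<close>.\<close>
  finally show ?thesis
    by (simp add: fact_eq_dfact mult_ac)
qed

theorem theorem7p3:
  fixes a b c :: nat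
  assumes "CARD('n::{finite,linorder}) \<ge> 2"
    and "even a" and "even b" and "even c"
  shows "f_fun TYPE('n) a b c 0 =
           real (fact (CARD('n) - 2)) * real (dfact (CARD('n) - 2)) / real (P_k (CARD('n) - 1) a b c 0)
           * (real (F_k 0 a b c 0) / real (F_k (CARD('n) - 2) a b c 0))
       \<and> f_fun TYPE('n) a b c 0 =
           real (fact (CARD('n) - 2)) * real (dfact a) * real (dfact b) * real (dfact c)
           / (real (dfact (a + CARD('n) - 2)) * real (dfact (b + CARD('n) - 2))
              * real (dfact (c + CARD('n) - 2)) * real (dfact (a + b + c + CARD('n) - 1)))"
proof -
  obtain n where n: "CARD('n) = n + 2"
    using assms(1) by (metis add.commute le_Suc_ex)
  obtain a' b' c' where abc: "a = 2 * a'" "b = 2 * b'" "c = 2 * c'"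
    using assms(2-4) by (auto elim!: evenE)
  \<comment> \<open>With \<open>n\<close> the dimension minus two, truncated subtraction disappears
    and the second factor in the denominator of \<open>f_fun\<close> cancels against
    \<open>Iint_corner\<close>.\<close>
  have e: "2 * x + (n + 2) - 2 = 2 * x + n" "2 * x + 2 * y + (n + 2) - 2 = 2 * x + 2 * y + n"
    "2 * x + 2 * y + 2 * z + (n + 2) - 1 = 2 * x + 2 * y + 2 * z + n + 1" for x y z
    by auto
  have explicit: "f_fun TYPE('n) a b c 0 =
      real (fact n) * real (dfact a) * real (dfact b) * real (dfact c)
      / (real (dfact (a + n)) * real (dfact (b + n)) * real (dfact (c + n)) * real (dfact (a + b + c + n + 1)))"
    unfolding f_fun_def abc n add_0_right e Iint_corner[OF n] by (simp add: mult_ac)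
  \<comment> \<open>In the first form, the argument \<open>d = 0\<close> contributes
    \<open>dfact 0 = 1\<close> to the upper \<open>F_k\<close> and \<open>dfact n\<close> to the
    lower one, which cancels the extra \<open>dfact n\<close> in front.\<close>
  then show ?thesis
    by (simp add: n P_k_def F_k_def mult_ac)
qed

end
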